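(* Let $0<p<1$ and $f(w)=w^p$ for $w\in[0,+\infty)$. For $\delta>0$, let $g$ be the smoothing of $f$ associated with $\delta$, and let $h(w):=f(w+\lambda)-f(\lambda)$, where $\lambda>0$ is chosen as a function of $\delta$ so that $g'(0)=h'(0)$. Then $$\frac{1}{\delta}\int_0^\delta\frac{g(w)}{f(w)}\,dw=\frac{3}{4-p}$$ (in particular this quantity is independent of $\delta$), and also $$\frac{1}{\delta}\int_0^\delta\frac{h(w)}{f(w)}\,dw$$ is independent of the choice of $\delta>0$.
   Context: For $f(w)=w^p$ with $0<p<1$ and $\delta>0$, the smoothing $g$ of $f$ associated with $\delta$ is defined by $g(w):=w^p$ for $w\in[\delta,+\infty)$, and $g(w):=Aw^3+Bw^2+Cw$ for $w\in[0,\delta]$, where $$A=\tfrac12\delta^{p-3}(p^2-3p+2),\qquad B=-\delta^{p-2}(p^2-4p+3),\qquad C=\tfrac12\delta^{p-1}(p^2-5p+6).$$ (These are the unique constants for which the cubic $Aw^3+Bw^2+Cw$ agrees with $f$ in value, first derivative and second derivative at $w=\delta$.) Here $g'(0)=C$ and $h'(0)=f'(\lambda)=p\lambda^{p-1}$, so the condition $g'(0)=h'(0)$ determines $\lambda=\delta\left(\frac{p^2-5p+6}{2p}\right)^{\frac{1}{p-1}}$ uniquely. *)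

theory Defs
  imports "HOL-Analysis.Analysis"
begin

definition pow_fun :: "real \<Rightarrow> real \<Rightarrow> real" where
  "pow_fun p w = w powr p"

definition coeff_A :: "real \<Rightarrow> real \<Rightarrow> real" where
  "coeff_A p \<delta> = 1/2 * \<delta> powr (p - 3) * (p^2 - 3 * p + 2)"

definition coeff_B :: "real \<Rightarrow> real \<Rightarrow> real" where
  "coeff_B p \<delta> = - (\<delta> powr (p - 2) * (p^2 - 4 * p + 3))"

definition coeff_C :: "real \<Rightarrow> real \<Rightarrow> real" where
  "coeff_C p \<delta> = 1/2 * \<delta> powr (p - 1) * (p^2 - 5 * p + 6)"

(* Only the values on [0, \<infinity>) are meaningful; the two branches agree at w = \<delta>. *)
definition smoothing :: "real \<Rightarrow> real \<Rightarrow> real \<Rightarrow> real" where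
  "smoothing p \<delta> w =
     (if \<delta> \<le> w then pow_fun p w
      else coeff_A p \<delta> * w^3 + coeff_B p \<delta> * w^2 + coeff_C p \<delta> * w)"

definition shifted :: "real \<Rightarrow> real \<Rightarrow> real \<Rightarrow> real" where
  "shifted p a w = pow_fun p (w + a) - pow_fun p a"

(* g'(0) = h'(0) for functions on [0, \<infinity>): both one-sided derivatives at 0 exist
   and coincide. *)
definition same_deriv_at_0 :: "(real \<Rightarrow> real) \<Rightarrow> (real \<Rightarrow> real) \<Rightarrow> bool" where
  "same_deriv_at_0 g h \<longleftrightarrow>
     (\<exists>D. (g has_real_derivative D) (at 0 within {0..}) \<and>
          (h has_real_derivative D) (at 0 within {0..}))"

lemma smoothing_deriv_0:
  assumes "\<delta> > 0"
  shows "(smoothing p \<delta> has_real_derivative coeff_C p \<delta>) (at 0 within {0..})"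
proof -
  have "((\<lambda>w. coeff_A p \<delta> * w^3 + coeff_B p \<delta> * w^2 + coeff_C p \<delta> * w)
          has_real_derivative coeff_C p \<delta>) (at 0 within {0..})"
    by (auto intro!: derivative_eq_intros)
  then show ?thesis
    by (rule has_field_derivative_transform_within[where d = \<delta>])
       (use assms in \<open>auto simp: smoothing_def dist_real_def\<close>)
qed

lemma shifted_deriv_0:
  assumes "a > 0"
  shows "(shifted p a has_real_derivative p * a powr (p - 1)) (at 0 within {0..})"
  unfolding shifted_def[abs_def] pow_fun_def
  using assms by (auto intro!: derivative_eq_intros)

lemma same_deriv_at_0_iff:
  assumes "\<delta> > 0" "a > 0"
  shows "same_deriv_at_0 (smoothing p \<delta>) (shifted p a) \<longleftrightarrow>
           coeff_C p \<delta> = p * a powr (p - 1)"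
proof -
  have nt: "at (0::real) within {0..} \<noteq> bot"
    using at_within_Ici_at_right[of "0::real"] by simp
  have uniq: "D = E" if "(k has_real_derivative D) (at 0 within {0..})"
      "(k has_real_derivative E) (at 0 within {0..})" for k :: "real \<Rightarrow> real" and D E
    using that nt unfolding has_field_derivative_iff by (metis tendsto_unique)
  show ?thesis
    unfolding same_deriv_at_0_def
    using smoothing_deriv_0[OF assms(1)] shifted_deriv_0[OF assms(2)] uniq by metis
qed

lemma same_deriv_at_0_iff_explicit:
  assumes "0 < p" "p < 1" "\<delta> > 0" "a > 0"
  shows "same_deriv_at_0 (smoothing p \<delta>) (shifted p a) \<longleftrightarrow>
           a = \<delta> * ((p^2 - 5 * p + 6) / (2 * p)) powr (1 / (p - 1))"
proof -
  define q where "q = (p^2 - 5 * p + 6) / (2 * p)"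
  have "p^2 - 5 * p + 6 = (2 - p) * (3 - p)" by (simp add: power2_eq_square algebra_simps)
  then have q: "q > 0" using assms by (simp add: q_def)
  have Cq: "coeff_C p \<delta> = p * (\<delta> powr (p - 1) * q)"
    using assms by (simp add: coeff_C_def q_def)
  have e: "(\<delta> * q powr (1 / (p - 1))) powr (p - 1) = \<delta> powr (p - 1) * q"
    using assms q by (simp add: powr_mult powr_powr)
  have "a = \<delta> * q powr (1 / (p - 1))"
    if "a powr (p - 1) = (\<delta> * q powr (1 / (p - 1))) powr (p - 1)"
  proof -
    have "(a powr (p - 1)) powr (1 / (p - 1)) =
          ((\<delta> * q powr (1 / (p - 1))) powr (p - 1)) powr (1 / (p - 1))"
      using that by simp
    then show ?thesis using assms q by (simp add: powr_powr)
  qed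
  then show ?thesis
    unfolding same_deriv_at_0_iff[OF assms(3,4)] Cq q_def[symmetric]
    using e assms(1) by auto
qed

end

theory Submission
  imports Defs
begin

text \<open>On \<open>(0, \<delta>]\<close> the first quotient is a combination of the powers \<open>w powr (3 - p)\<close>,
  \<open>w powr (2 - p)\<close> and \<open>w powr (1 - p)\<close>, which is integrated explicitly. For the second one, the
  matching condition says that \<open>\<lambda>\<close> is a constant multiple \<open>\<kappa> * \<delta>\<close> of \<open>\<delta>\<close>; as \<open>f\<close> is
  homogeneous, the quotient is the dilation by \<open>\<delta>\<close> of the quotient for \<open>\<delta> = 1\<close>, so its mean over
  \<open>[0, \<delta>]\<close> is the integral of the latter over \<open>[0, 1]\<close>.\<close>

lemma smoothing_quotient:
  assumes "0 < w" "w < \<delta>"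
  shows "smoothing p \<delta> w / pow_fun p w =
    coeff_A p \<delta> * w powr (3 - p) + coeff_B p \<delta> * w powr (2 - p) + coeff_C p \<delta> * w powr (1 - p)"
  using assms by (simp add: smoothing_def pow_fun_def powr_diff powr_numeral field_simps)

lemma has_integral_smoothing_quotient:
  assumes "0 < p" "p < 1" "\<delta> > 0"
  shows "((\<lambda>w. smoothing p \<delta> w / pow_fun p w) has_integral (3 / (4 - p) * \<delta>)) {0..\<delta>}"
proof -
  let ?I = "coeff_A p \<delta> * (\<delta> powr (4 - p) / (4 - p)) + coeff_B p \<delta> * (\<delta> powr (3 - p) / (3 - p))
    + coeff_C p \<delta> * (\<delta> powr (2 - p) / (2 - p))"
  have pow: "((\<lambda>w. w powr a) has_integral (\<delta> powr b / b)) {0..\<delta>}" if "a > -1" "b = a + 1" for a b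
    using has_integral_powr_from_0[of a \<delta>] that assms(3) by simp
  have I: "((\<lambda>w. coeff_A p \<delta> * w powr (3 - p) + coeff_B p \<delta> * w powr (2 - p)
      + coeff_C p \<delta> * w powr (1 - p)) has_integral ?I) {0..\<delta>}"
    by (intro has_integral_add has_integral_mult_right pow) (use assms in auto)
  have "?I = 3 / (4 - p) * \<delta>"
  proof -
    \<comment> \<open>The powers of \<open>\<delta>\<close> in each coefficient and in the matching
      integrated monomial have exponents adding up to 1, and the quadratics in \<open>p\<close>
      split into linear factors that partly cancel against the denominators.\<close>
    have A: "coeff_A p \<delta> * \<delta> powr (4 - p) = (1 - p) * (2 - p) / 2 * \<delta>"
    proof -
      have "coeff_A p \<delta> * \<delta> powr (4 - p) = (1 - p) * (2 - p) / 2 * (\<delta> powr (p - 3) * \<delta> powr (4 - p))"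
        by (simp add: coeff_A_def power2_eq_square algebra_simps)
      also have "\<delta> powr (p - 3) * \<delta> powr (4 - p) = \<delta>"
        using assms(3) by (simp flip: powr_add)
      finally show ?thesis .
    qed
    have B: "coeff_B p \<delta> * \<delta> powr (3 - p) = - ((1 - p) * (3 - p)) * \<delta>"
    proof -
      have "coeff_B p \<delta> * \<delta> powr (3 - p) = - ((1 - p) * (3 - p)) * (\<delta> powr (p - 2) * \<delta> powr (3 - p))"
        by (simp add: coeff_B_def power2_eq_square algebra_simps)
      also have "\<delta> powr (p - 2) * \<delta> powr (3 - p) = \<delta>"
        using assms(3) by (simp flip: powr_add)
      finally show ?thesis .
    qed
    have C: "coeff_C p \<delta> * \<delta> powr (2 - p) = (2 - p) * (3 - p) / 2 * \<delta>"
    proof -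
      have "coeff_C p \<delta> * \<delta> powr (2 - p) = (2 - p) * (3 - p) / 2 * (\<delta> powr (p - 1) * \<delta> powr (2 - p))"
        by (simp add: coeff_C_def power2_eq_square algebra_simps)
      also have "\<delta> powr (p - 1) * \<delta> powr (2 - p) = \<delta>"
        using assms(3) by (simp flip: powr_add)
      finally show ?thesis .
    qed
    have "?I = (1 - p) * (2 - p) / 2 * \<delta> / (4 - p) + - ((1 - p) * (3 - p)) * \<delta> / (3 - p)
        + (2 - p) * (3 - p) / 2 * \<delta> / (2 - p)"
      by (simp only: A B C times_divide_eq_right)
    also have "\<dots> = (1 - p) * (2 - p) / 2 * \<delta> / (4 - p) - (1 - p) * \<delta> + (3 - p) / 2 * \<delta>"
      using assms by (simp add: divide_simps) (simp add: algebra_simps)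
    \<comment> \<open>The last two terms add up to \<open>(1 + p) / 2 * \<delta>\<close>. Over the
      denominator \<open>2 * (4 - p)\<close> the numerator becomes
      \<open>(1 - p) * (2 - p) + (1 + p) * (4 - p) = 6\<close>.\<close>
    also have "\<dots> = 3 / (4 - p) * \<delta>"
      using assms by (simp add: field_simps)
    finally show ?thesis .
  qed
  with I have "((\<lambda>w. coeff_A p \<delta> * w powr (3 - p) + coeff_B p \<delta> * w powr (2 - p)
      + coeff_C p \<delta> * w powr (1 - p)) has_integral (3 / (4 - p) * \<delta>)) {0..\<delta>}"
    by simp
  \<comment> \<open>The expansion of the quotient is at hand only on the open interval, since at
    \<open>\<delta>\<close> the power branch of \<open>smoothing\<close> applies; two points do not
    change the integral.\<close>
  then show ?thesis
    by (rule has_integral_spike_finite[rotated 2, where S = "{0, \<delta>}"])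
       (auto simp: smoothing_quotient)
qed

text \<open>This yields integrability up to the endpoint 0, where the denominator vanishes. Near 0
  the quotient is a difference quotient with a finite limit, times \<open>w powr (1 - p)\<close>,
  which tends to 0 because \<open>p < 1\<close>.\<close>

lemma continuous_on_shifted_quotient:
  assumes "p < 1" "a > 0"
  shows "continuous_on {0..} (\<lambda>w. shifted p a w / pow_fun p w)"
proof (rule continuous_on_eq_continuous_within[THEN iffD2], rule ballI)
  fix x :: real assume x: "x \<in> {0..}"
  show "continuous (at x within {0..}) (\<lambda>w. shifted p a w / pow_fun p w)"
  proof (cases "x = 0")
    case True
    have "((\<lambda>w. shifted p a w / w) \<longlongrightarrow> p * a powr (p - 1)) (at 0 within {0..})"
      using shifted_deriv_0[OF assms(2)]
      by (simp add: has_field_derivative_iff shifted_def)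
    moreover have "((\<lambda>w. w powr (1 - p)) \<longlongrightarrow> 0 powr (1 - p)) (at 0 within {0..})"
      by (rule tendsto_powr2) (use assms in \<open>auto simp: eventually_at_filter\<close>)
    ultimately have "((\<lambda>w. shifted p a w / w * w powr (1 - p)) \<longlongrightarrow> 0) (at 0 within {0..})"
      using tendsto_mult by fastforce
    moreover have "shifted p a w / w * w powr (1 - p) = shifted p a w / pow_fun p w"
      if "w > 0" for w
      using that by (simp add: pow_fun_def powr_diff)
    ultimately have "((\<lambda>w. shifted p a w / pow_fun p w) \<longlongrightarrow> 0) (at 0 within {0..})"
      by (elim Lim_transform_eventually) (auto simp: eventually_at_filter)
    \<comment> \<open>The value at 0 is a division by zero, hence 0, which is exactly the
      limit.\<close>
    then show ?thesis
      by (simp add: True continuous_within pow_fun_def)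
  next
    case False
    with x assms show ?thesis
      unfolding shifted_def pow_fun_def
      by (intro continuous_intros) auto
  qed
qed

lemma shifted_quotient_scale:
  assumes "\<delta> > 0" "\<kappa> > 0" "w \<ge> 0"
  shows "shifted p (\<delta> * \<kappa>) w / pow_fun p w
    = shifted p \<kappa> (w / \<delta>) / pow_fun p (w / \<delta>)"
proof -
  have "w + \<delta> * \<kappa> = \<delta> * (w / \<delta> + \<kappa>)"
    using assms by (simp add: field_simps)
  then have "shifted p (\<delta> * \<kappa>) w = \<delta> powr p * shifted p \<kappa> (w / \<delta>)"
    using assms by (simp add: shifted_def pow_fun_def powr_mult right_diff_distrib)
  then show ?thesis
    using assms by (simp add: pow_fun_def powr_divide)
qed

lemma has_integral_shifted_quotient:
  assumes "p < 1" "\<delta> > 0" "\<kappa> > 0"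
  shows "((\<lambda>w. shifted p (\<delta> * \<kappa>) w / pow_fun p w) has_integral
    (\<delta> * integral {0..1} (\<lambda>w. shifted p \<kappa> w / pow_fun p w))) {0..\<delta>}"
proof -
  let ?q = "\<lambda>w. shifted p \<kappa> w / pow_fun p w"
  have "?q integrable_on {0..1}"
    by (intro integrable_continuous_real continuous_on_subset[OF continuous_on_shifted_quotient])
       (use assms in auto)
  then have "(?q has_integral integral {0..1} ?q) (cbox 0 1)"
    by (simp add: has_integral_integral)
  \<comment> \<open>Substituting \<open>w / \<delta>\<close> pulls the interval back to
    \<open>{0..\<delta>}\<close> and contributes the factor \<open>\<delta>\<close>, which the mean
    later divides out.\<close>
  from has_integral_affinity[OF this, of "1 / \<delta>" 0] assms(2)
  have "((\<lambda>w. ?q (w / \<delta>)) has_integral (\<delta> * integral {0..1} ?q)) {0..\<delta>}"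
    by (simp add: image_mult_atLeastAtMost_if)
  then show ?thesis
    by (rule has_integral_eq[rotated])
       (use assms in \<open>simp add: shifted_quotient_scale\<close>)
qed

theorem theorem11:
  fixes p :: real and lam :: "real \<Rightarrow> real"
  assumes p: "0 < p" "p < 1"
    and lam_pos: "\<And>\<delta>. \<delta> > 0 \<Longrightarrow> lam \<delta> > 0"
    and lam_deriv: "\<And>\<delta>. \<delta> > 0 \<Longrightarrow> same_deriv_at_0 (smoothing p \<delta>) (shifted p (lam \<delta>))"
  shows "(\<forall>\<delta>>0. (\<lambda>w. smoothing p \<delta> w / pow_fun p w) integrable_on {0..\<delta>} \<and>
            1 / \<delta> * integral {0..\<delta>} (\<lambda>w. smoothing p \<delta> w / pow_fun p w) = 3 / (4 - p))
       \<and> (\<exists>c. \<forall>\<delta>>0. (\<lambda>w. shifted p (lam \<delta>) w / pow_fun p w) integrable_on {0..\<delta>} \<and>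
            1 / \<delta> * integral {0..\<delta>} (\<lambda>w. shifted p (lam \<delta>) w / pow_fun p w) = c)"
proof -
  define \<kappa> where "\<kappa> = ((p^2 - 5 * p + 6) / (2 * p)) powr (1 / (p - 1))"
  have lam: "lam \<delta> = \<delta> * \<kappa>" if "\<delta> > 0" for \<delta>
    using same_deriv_at_0_iff_explicit[OF p that lam_pos[OF that]] lam_deriv[OF that]
    by (simp add: \<kappa>_def)
  \<comment> \<open>Since \<open>\<kappa> = lam 1\<close>, positivity comes from the hypothesis on
    \<open>lam\<close>, without examining the closed form.\<close>
  have \<kappa>: "\<kappa> > 0"
    using lam[of 1] lam_pos[of 1] by simp
  have mean: "f integrable_on {0..\<delta>} \<and> 1 / \<delta> * integral {0..\<delta>} f = c"
    if "(f has_integral (\<delta> * c)) {0..\<delta>}" "\<delta> > 0" for f :: "real \<Rightarrow> real" and \<delta> c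
    using that by (auto simp: integral_unique)
  show ?thesis
  \<comment> \<open>The constant stays open here and is fixed by the second \<open>show\<close> as
    an integral free of \<open>\<delta>\<close>.\<close>
  proof (intro conjI[OF _ exI] allI impI)
    fix \<delta> :: real assume \<delta>: "\<delta> > 0"
    show "(\<lambda>w. smoothing p \<delta> w / pow_fun p w) integrable_on {0..\<delta>} \<and>
      1 / \<delta> * integral {0..\<delta>} (\<lambda>w. smoothing p \<delta> w / pow_fun p w) = 3 / (4 - p)"
      using has_integral_smoothing_quotient[OF p \<delta>] \<delta>
      by (intro mean) (simp_all add: mult.commute)
    show "(\<lambda>w. shifted p (lam \<delta>) w / pow_fun p w) integrable_on {0..\<delta>} \<and>
      1 / \<delta> * integral {0..\<delta>} (\<lambda>w. shifted p (lam \<delta>) w / pow_fun p w)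
        = integral {0..1} (\<lambda>w. shifted p \<kappa> w / pow_fun p w)"
      using has_integral_shifted_quotient[OF p(2) \<delta> \<kappa>] \<delta>
      by (intro mean) (simp_all add: lam)
  qed
qed

end
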